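(* Let $E$ be an analytic equivalence relation on a Polish space $X$ with uncountably many classes but not perfectly many classes. Let $I_E$ be the $\sigma$-ideal on $X$ generated by the $E$-equivalence classes. Then for every Borel $I_E$-positive set $B\subseteq X$, the restriction $E\restriction_B=E\cap(B\times B)$ is not Borel.
   Context: $E$ has perfectly many classes if there is a perfect set $P\subseteq X$ of pairwise $E$-inequivalent elements. The $\sigma$-ideal generated by the equivalence classes consists of all subsets of countable unions of $E$-classes. A set $B$ is $I_E$-positive if $B\notin I_E$. *)

theory Defs
  imports "HOL-Analysis.Analysis"
begin

text \<open>
  Polish spaces are the types of class \<^class>\<open>polish_space\<close>: types carrying a complete metric whose
  topology is second countable.  None of the notions below depends on the metric beyond the
  topology it induces.
\<close>

text \<open>
  \<open>nat \<Rightarrow> nat\<close> carries the product of the discrete topologies, so it is the Baire space.  Every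
  nonempty Polish space is a continuous image of it, so ``continuous image of a Polish space'' may
  be expressed with this single domain; the empty set has to be added separately.  The notion is
  only meant for Polish ambient spaces; it is typed more generally because the library has no
  instance of \<^class>\<open>polish_space\<close> for products.
\<close>

definition analytic_set :: "'a::topological_space set \<Rightarrow> bool"
  where "analytic_set A \<longleftrightarrow>
    A = {} \<or> (\<exists>f :: (nat \<Rightarrow> nat) \<Rightarrow> 'a. continuous_on UNIV f \<and> range f = A)"

text \<open>Perfect sets are nonempty by convention; otherwise having perfectly many classes would be trivial.\<close>

definition perfect_set :: "'a::topological_space set \<Rightarrow> bool"
  where "perfect_set P \<longleftrightarrow> P \<noteq> {} \<and> closed P \<and> (\<forall>x\<in>P. x islimpt P)"

definition perfectly_many_classes :: "('a::topological_space \<times> 'a) set \<Rightarrow> bool"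
  where "perfectly_many_classes E \<longleftrightarrow>
    (\<exists>P. perfect_set P \<and> (\<forall>x\<in>P. \<forall>y\<in>P. x \<noteq> y \<longrightarrow> (x, y) \<notin> E))"

definition class_ideal :: "('a \<times> 'a) set \<Rightarrow> 'a set set"
  where "class_ideal E = {A. \<exists>\<C>. \<C> \<subseteq> UNIV // E \<and> countable \<C> \<and> A \<subseteq> \<Union>\<C>}"

end

theory Submission
  imports Defs
begin

text \<open>
  If \<open>E\<close> restricted to \<open>B\<close> is Borel, then so is the graph \<open>R = B
  \<times> B - E\<close> of inequivalence on \<open>B\<close>. Silver's dichotomy for Borel
  equivalence relations says that an uncountable number of classes meeting \<open>B\<close> yields a
  perfect set of inequivalent points; the proof below is along the lines of the
  \<open>G\<^sub>0\<close>-dichotomy for \<open>R\<close>, followed by a category argument on the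
  Cantor space.

  An \<open>R\<close>-independent set meets \<open>B\<close> inside a single class, so a set
  \<open>B\<close> outside \<open>class_ideal E\<close> prevents the space from being covered by
  countably many independent sets. A Borel set is the projection of a closed set \<open>F\<close>
  along the Baire space (\<open>borel_imp_projection_of_closed\<close>), and from this one builds a
  continuous map \<open>\<phi>\<close> from the Cantor space that sends the edges of a fixed sparse
  graph to pairs in \<open>R\<close> (\<open>continuous_homomorphism\<close>). The map is a limit of
  finite copies of the graph in which every edge carries its witness for \<open>F\<close>. The
  construction never gets stuck because the sets of copies in use are not negligible, in a sense
  given by countably many independent sets, and because the extensions of a non-negligible set of
  copies form a non-negligible set (\<open>extensions_not_negligible\<close>).

  The preimage of \<open>E\<close> under \<open>\<phi>\<close> is a Borel equivalence relation on
  the Cantor space, thus has the Baire property, and it contains no edge of the graph. The edges are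
  changes of one coordinate and occur in every basic open set, so an equivalence relation that is
  comeager in some open set would contain an edge; the preimage is therefore meager
  (\<open>equivalence_avoiding_edges_meager\<close>). By Mycielski's theorem
  (\<open>comeager_square_contains_cantor_square\<close>) a meager relation avoids all pairs of
  distinct points of some copy of the Cantor space, whose image under \<open>\<phi>\<close> is the
  perfect set.
\<close>

section \<open>Borel sets as projections\<close>

text \<open>Membership is certified by a witness subject to a closed condition. Hence if points and their
  witnesses converge together, the limit point has a witness too.\<close>

definition projection_of_closed :: "'y::topological_space set \<Rightarrow> bool"
  where "projection_of_closed A \<longleftrightarrow> (\<exists>F :: ('y \<times> (nat \<Rightarrow> nat)) set. closed F \<and> A = fst ` F)"

lemma projection_of_closed_closed:
  assumes "closed A"
  shows "projection_of_closed A"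
  unfolding projection_of_closed_def
  by (rule exI[of _ "A \<times> UNIV"]) (use assms in \<open>auto simp: closed_Times\<close>)

text \<open>The first entry of the witness selects the member of the union, the remaining entries
  witness membership in it.\<close>

lemma projection_of_closed_Union:
  fixes A :: "nat \<Rightarrow> 'y::topological_space set"
  assumes "\<And>n. projection_of_closed (A n)"
  shows "projection_of_closed (\<Union>n. A n)"
proof -
  obtain F where F: "\<And>n. closed (F n)" "\<And>n. A n = fst ` (F n :: ('y \<times> (nat \<Rightarrow> nat)) set)"
    using assms unfolding projection_of_closed_def by metis
  define G where "G = (\<Inter>n. {p :: 'y \<times> (nat \<Rightarrow> nat). snd p 0 \<noteq> n} \<union>
    (\<lambda>p. (fst p, \<lambda>i. snd p (Suc i))) -` F n)"
  have "continuous_on UNIV (\<lambda>p :: 'y \<times> (nat \<Rightarrow> nat). snd p i)" for i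
    by (rule continuous_on_compose2[of UNIV "\<lambda>z. z i"]) (simp_all add: continuous_on_snd)
  note c = this
  have "closed ((\<lambda>p :: 'y \<times> (nat \<Rightarrow> nat). snd p 0) -` {m. m \<noteq> n})" for n :: nat
    by (rule closed_vimage[OF _ c]) (simp add: closed_def open_discrete)
  moreover have "closed ((\<lambda>p. (fst p, \<lambda>i. snd p (Suc i))) -` F n)" for n
    by (rule closed_vimage[OF F(1)]) (intro continuous_intros c)
  ultimately have "closed G"
    unfolding G_def by (intro closed_INT ballI closed_Un) (auto simp: vimage_def)
  moreover have "(\<Union>n. A n) = fst ` G"
  proof safe
    fix n a assume "a \<in> A n"
    then obtain z where "(a, z) \<in> F n" using F(2) by force
    then have "(a, case_nat n z) \<in> G" by (auto simp: G_def)
    then show "a \<in> fst ` G" by force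
  next
    fix a z assume "(a, z) \<in> G"
    then have "(a, \<lambda>i. z (Suc i)) \<in> F (z 0)" by (auto simp: G_def)
    then show "fst (a, z) \<in> (\<Union>n. A n)" using F(2) by force
  qed
  ultimately show ?thesis unfolding projection_of_closed_def by blast
qed

text \<open>One witness codes a whole sequence of witnesses, by way of a pairing function.\<close>

lemma projection_of_closed_Inter:
  fixes A :: "nat \<Rightarrow> 'y::topological_space set"
  assumes "\<And>n. projection_of_closed (A n)"
  shows "projection_of_closed (\<Inter>n. A n)"
proof -
  obtain F where F: "\<And>n. closed (F n)" "\<And>n. A n = fst ` (F n :: ('y \<times> (nat \<Rightarrow> nat)) set)"
    using assms unfolding projection_of_closed_def by metis
  define G where "G = (\<Inter>n. (\<lambda>p. (fst p, \<lambda>i. snd p (prod_encode (n, i)))) -` F n)"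
  have c: "continuous_on UNIV (\<lambda>p :: 'y \<times> (nat \<Rightarrow> nat). snd p i)" for i
    by (rule continuous_on_compose2[of UNIV "\<lambda>z. z i"]) (simp_all add: continuous_on_snd)
  have "closed ((\<lambda>p. (fst p, \<lambda>i. snd p (prod_encode (n, i)))) -` F n)" for n
    by (rule closed_vimage[OF F(1)]) (intro continuous_intros c)
  then have "closed G"
    unfolding G_def by blast
  moreover have "(\<Inter>n. A n) = fst ` G"
  proof safe
    fix a assume "a \<in> (\<Inter>n. A n)"
    then have "\<forall>n. \<exists>z. (a, z) \<in> F n" using F(2) by force
    then obtain z where z: "\<And>n. (a, z n) \<in> F n" by metis
    have "(a, \<lambda>j. case prod_decode j of (n, i) \<Rightarrow> z n i) \<in> G"
      using z by (auto simp: G_def)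
    then show "a \<in> fst ` G" by force
  next
    fix n a z assume "(a, z) \<in> G"
    then have "(a, \<lambda>i. z (prod_encode (n, i))) \<in> F n" by (auto simp: G_def)
    then show "fst (a, z) \<in> A n" using F(2) by force
  qed
  ultimately show ?thesis unfolding projection_of_closed_def by blast
qed

lemma projection_of_closed_open:
  fixes S :: "'y::metric_space set"
  assumes "open S"
  shows "projection_of_closed S"
proof (cases "S = UNIV")
  case True
  then show ?thesis by (simp add: projection_of_closed_closed)
next
  case False
  have "S = (\<Union>n. {x. inverse (real (Suc n)) \<le> infdist x (- S)})"
  proof safe
    fix x assume "x \<in> S"
    then have "infdist x (- S) > 0"
      using assms False infdist_pos_not_in_closed[of "- S" x] by auto
    then obtain n where "inverse (real (Suc n)) < infdist x (- S)"
      using reals_Archimedean by blast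
    then show "x \<in> (\<Union>n. {x. inverse (real (Suc n)) \<le> infdist x (- S)})"
      by (auto intro: less_imp_le)
  next
    fix x n assume *: "inverse (real (Suc n)) \<le> infdist x (- S)"
    show "x \<in> S"
    proof (rule ccontr)
      assume "x \<notin> S"
      then have "infdist x (- S) = 0" by (intro infdist_zero) auto
      with * show False by (simp add: inverse_eq_divide divide_le_0_iff)
    qed
  qed
  moreover have "projection_of_closed {x. inverse (real (Suc n)) \<le> infdist x (- S)}" for n
    by (intro projection_of_closed_closed closed_Collect_le continuous_intros)
  then have "projection_of_closed (\<Union>n. {x. inverse (real (Suc n)) \<le> infdist x (- S)})"
    by (rule projection_of_closed_Union)
  ultimately show ?thesis by (rule ssubst)
qed

lemma borel_imp_projection_of_closed:
  fixes A :: "'y::metric_space set"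
  assumes "A \<in> sets borel"
  shows "projection_of_closed A"
proof -
  have "A \<in> sigma_sets UNIV {S :: 'y set. open S}"
    using assms by (simp add: sets_borel)
  \<comment> \<open>Complements become harmless once the claim is made for a set and its complement together.\<close>
  then have "projection_of_closed A \<and> projection_of_closed (- A)"
  proof (induction rule: sigma_sets.induct)
    case (Basic A)
    then show ?case
      by (simp add: projection_of_closed_open projection_of_closed_closed closed_Compl)
  next
    case Empty
    then show ?case by (simp add: projection_of_closed_closed)
  next
    case (Compl A)
    then show ?case by (simp add: Compl_eq_Diff_UNIV[symmetric])
  next
    case (Union A)
    have "- (\<Union>n. A n) = (\<Inter>n. - A n)" by auto
    then show ?case
      using Union projection_of_closed_Union[of A]
        projection_of_closed_Inter[of "\<lambda>n. - A n"] by auto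
  qed
  then show ?thesis ..
qed

section \<open>Category\<close>

definition comeager :: "'y::topological_space set \<Rightarrow> bool"
  where "comeager C \<longleftrightarrow>
    (\<exists>\<D>. countable \<D> \<and> (\<forall>D\<in>\<D>. open D \<and> closure D = UNIV) \<and> \<Inter>\<D> \<subseteq> C)"

definition baire_property :: "'y::topological_space set \<Rightarrow> bool"
  where "baire_property A \<longleftrightarrow> (\<exists>U. open U \<and> comeager {x. x \<in> A \<longleftrightarrow> x \<in> U})"

lemma comeager_mono:
  assumes "comeager C" "C \<subseteq> C'"
  shows "comeager C'"
proof -
  obtain \<D> where "countable \<D>" "\<forall>D\<in>\<D>. open D \<and> closure D = UNIV" "\<Inter>\<D> \<subseteq> C"
    using assms(1) unfolding comeager_def by (elim exE conjE)
  moreover from this(3) assms(2) have "\<Inter>\<D> \<subseteq> C'" by (rule subset_trans)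
  ultimately show ?thesis
    unfolding comeager_def by (intro exI[of _ \<D>]) simp
qed

lemma comeager_open_dense:
  assumes "open D" "closure D = UNIV"
  shows "comeager D"
proof -
  have "countable {D}" "\<forall>D'\<in>{D}. open D' \<and> closure D' = UNIV" "\<Inter>{D} \<subseteq> D"
    using assms by simp_all
  then show ?thesis
    unfolding comeager_def by (intro exI[of _ "{D}"] conjI)
qed

lemma comeager_INT:
  assumes "countable I" "\<And>i. i \<in> I \<Longrightarrow> comeager (C i)"
  shows "comeager (\<Inter>i\<in>I. C i)"
proof -
  obtain \<D> where "\<And>i. i \<in> I \<Longrightarrow>
      countable (\<D> i) \<and> (\<forall>D\<in>\<D> i. open D \<and> closure D = UNIV) \<and> \<Inter>(\<D> i) \<subseteq> C i"
    using assms(2) unfolding comeager_def by metis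
  then show ?thesis
    unfolding comeager_def using assms(1) by (intro exI[of _ "\<Union>i\<in>I. \<D> i"]) fastforce
qed

lemma comeager_Int:
  assumes "comeager C" "comeager C'"
  shows "comeager (C \<inter> C')"
proof -
  have "comeager (\<Inter>b. if b then C else C')"
    by (rule comeager_INT) (use assms in auto)
  then show ?thesis by (rule comeager_mono) (auto split: if_splits)
qed

lemma baire_property_open:
  assumes "open U"
  shows "baire_property U"
proof -
  have "comeager (UNIV :: 'a::topological_space set)"
    by (rule comeager_open_dense) simp_all
  then have "comeager {x. x \<in> U \<longleftrightarrow> x \<in> U}"
    by simp
  with assms show ?thesis
    unfolding baire_property_def by (intro exI conjI)
qed

text \<open>The boundary of an open set is nowhere dense, so off a meager set the complement of \<open>U\<close> agrees
  with its interior.\<close>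

lemma baire_property_Compl:
  assumes "baire_property A"
  shows "baire_property (- A)"
proof -
  obtain U where U: "open U" "comeager {x. x \<in> A \<longleftrightarrow> x \<in> U}"
    using assms unfolding baire_property_def by blast
  let ?V = "interior (- U)"
  have "closure (U \<union> ?V) = UNIV"
    using closure_subset[of U] closure_subset[of "- closure U"] by (auto simp: interior_closure)
  then have "comeager (U \<union> ?V)"
    using U(1) by (intro comeager_open_dense) auto
  then have "comeager ({x. x \<in> A \<longleftrightarrow> x \<in> U} \<inter> (U \<union> ?V))"
    using U(2) by (rule comeager_Int[rotated])
  then have "comeager {x. x \<in> - A \<longleftrightarrow> x \<in> ?V}"
    by (rule comeager_mono) (use interior_subset[of "- U"] in auto)
  then show ?thesis
    unfolding baire_property_def by (intro exI[of _ ?V]) auto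
qed

lemma baire_property_UN:
  fixes A :: "nat \<Rightarrow> 'y::topological_space set"
  assumes "\<And>n. baire_property (A n)"
  shows "baire_property (\<Union>n. A n)"
proof -
  obtain U where U: "\<And>n. open (U n)" "\<And>n. comeager {x. x \<in> A n \<longleftrightarrow> x \<in> U n}"
    using assms unfolding baire_property_def by metis
  have "comeager (\<Inter>n. {x. x \<in> A n \<longleftrightarrow> x \<in> U n})"
    using U(2) by (intro comeager_INT) auto
  then have "comeager {x. x \<in> (\<Union>n. A n) \<longleftrightarrow> x \<in> (\<Union>n. U n)}"
    by (rule comeager_mono) auto
  then show ?thesis
    unfolding baire_property_def using U(1) by (intro exI[of _ "\<Union>n. U n"]) auto
qed

lemma borel_imp_baire_property:
  assumes "A \<in> sets borel"
  shows "baire_property A"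
proof -
  have "A \<in> sigma_sets UNIV {S. open S}"
    using assms by (simp add: sets_borel)
  then show ?thesis
  proof (induction rule: sigma_sets.induct)
    case (Basic A)
    then show ?case by (simp add: baire_property_open)
  next
    case Empty
    show ?case by (rule baire_property_open) simp
  next
    case (Compl A)
    then show ?case using baire_property_Compl[of A] by (simp add: Compl_eq_Diff_UNIV)
  next
    case (Union A)
    then show ?case using baire_property_UN[of A] by blast
  qed
qed

section \<open>The Cantor space\<close>

text \<open>Finite initial segments are recorded latest entry first, so that prolonging a segment is
  \<^const>\<open>Cons\<close> and an initial segment of a segment is a suffix of the list.\<close>

primrec hist :: "(nat \<Rightarrow> bool) \<Rightarrow> nat \<Rightarrow> bool list" where
  "hist x 0 = []"
| "hist x (Suc n) = x n # hist x n"

lemma length_hist [simp]: "length (hist x n) = n"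
  by (induction n) auto

lemma hist_eq_iff: "hist x n = hist y n \<longleftrightarrow> (\<forall>i<n. x i = y i)"
  by (induction n) (auto simp: less_Suc_eq)

lemma hist_add: "hist x (n + m) = hist (\<lambda>i. x (n + i)) m @ hist x n"
  by (induction m) auto

lemma ex_hist: "\<exists>x. hist x (length u) = u"
proof (induction u)
  case (Cons b u)
  then obtain x where x: "hist x (length u) = u" by blast
  have "hist (x(length u := b)) (length u) = hist x (length u)" by (simp add: hist_eq_iff)
  with x have "hist (x(length u := b)) (length (b # u)) = b # u" by (simp del: fun_upd_apply add: fun_upd_same)
  then show ?case by (intro exI[of _ "x(length u := b)"])
qed simp

definition cyl :: "bool list \<Rightarrow> (nat \<Rightarrow> bool) set"
  where "cyl u = {x. hist x (length u) = u}"

lemma cyl_append: "cyl (w @ u) \<subseteq> cyl u"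
proof
  fix x assume "x \<in> cyl (w @ u)"
  then have "hist x (length u + length w) = w @ u" by (simp add: cyl_def add.commute)
  then show "x \<in> cyl u" by (simp add: cyl_def hist_add)
qed

lemma hist_extends:
  assumes "x \<in> cyl u" "length u \<le> m"
  shows "\<exists>w. hist x m = w @ u"
  using assms hist_add[of x "length u" "m - length u"] by (auto simp: cyl_def)

lemma cyl_agree: "x \<in> cyl u \<Longrightarrow> y \<in> cyl u \<Longrightarrow> i < length u \<Longrightarrow> x i = y i"
  by (metis (mono_tags, lifting) cyl_def hist_eq_iff mem_Collect_eq)

lemma cyl_nonempty: "cyl u \<noteq> {}"
  using ex_hist[of u] by (auto simp: cyl_def)

lemma mem_cyl_hist [simp]: "x \<in> cyl (hist x n)"
  by (simp add: cyl_def)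

lemma cyl_hist: "cyl (hist x n) = {y. \<forall>i<n. y i = x i}"
  by (auto simp: cyl_def hist_eq_iff)

lemma open_cyl: "open (cyl u)"
proof -
  obtain x where x: "hist x (length u) = u" using ex_hist by blast
  have "open ((\<lambda>y. y i) -` {x i} :: (nat \<Rightarrow> bool) set)" for i
    by (rule open_vimage) (auto simp: open_discrete)
  then have "open (\<Inter>i<length u. (\<lambda>y. y i) -` {x i} :: (nat \<Rightarrow> bool) set)" by blast
  also have "(\<Inter>i<length u. (\<lambda>y. y i) -` {x i}) = cyl u"
    using x cyl_hist[of x "length u"] by auto
  finally show ?thesis .
qed

lemma continuous_on_finitely_determined:
  assumes "\<And>x y. hist x n = hist y n \<Longrightarrow> f x = f y"
  shows "continuous_on UNIV f"
proof -
  have "open (f -` B)" for B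
  proof -
    have eq: "f -` B = (\<Union>x\<in>f -` B. cyl (hist x n))"
    proof (intro equalityI subsetI)
      fix y assume "y \<in> (\<Union>x\<in>f -` B. cyl (hist x n))"
      then obtain x where x: "f x \<in> B" "hist y n = hist x n" by (auto simp: cyl_def)
      from x(2) have "f y = f x" by (rule assms)
      with x(1) show "y \<in> f -` B" by simp
    qed (use mem_cyl_hist in blast)
    show ?thesis by (subst eq) (intro open_UN ballI open_cyl)
  qed
  then show ?thesis by (simp add: continuous_on_open_vimage)
qed

lemma nested_cyl_nonempty:
  assumes "\<And>n. \<exists>w. c (Suc n) = w @ c n \<and> w \<noteq> []"
  shows "\<exists>z. \<forall>n. z \<in> cyl (c n)"
proof -
  have len: "n \<le> length (c n)" for n
  proof (induction n)
    case (Suc n)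
    obtain w where "c (Suc n) = w @ c n" "w \<noteq> []" using assms by blast
    then have "length (c n) < length (c (Suc n))" by simp
    with Suc show ?case by linarith
  qed simp
  have mono: "cyl (c m) \<subseteq> cyl (c n)" if "n \<le> m" for n m
  proof (rule lift_Suc_antimono_le[of "\<lambda>n. cyl (c n)", OF _ that])
    show "cyl (c (Suc n)) \<subseteq> cyl (c n)" for n using assms[of n] cyl_append by metis
  qed
  have "\<forall>n. \<exists>x. x \<in> cyl (c n)" using cyl_nonempty by blast
  then obtain x where x: "\<And>n. x n \<in> cyl (c n)" by metis
  \<comment> \<open>The list of index \<open>i + 1\<close> has more than \<open>i\<close> entries and so decides entry \<open>i\<close>.\<close>
  define z where "z i = x (Suc i) i" for i
  have "z i = x n i" if "i < length (c n)" for n i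
  proof (cases "Suc i \<le> n")
    case True
    have "x n \<in> cyl (c (Suc i))" using x[of n] mono[OF True] by (rule rev_subsetD)
    then show ?thesis unfolding z_def using x len[of "Suc i"] by (intro cyl_agree) auto
  next
    case False
    then have "x (Suc i) \<in> cyl (c n)" using x mono[of n "Suc i"] by auto
    then show ?thesis unfolding z_def using x that by (intro cyl_agree) auto
  qed
  then have "hist z (length (c n)) = hist (x n) (length (c n))" for n
    by (simp add: hist_eq_iff)
  then have "z \<in> cyl (c n)" for n using x[of n] by (simp add: cyl_def)
  then show ?thesis by blast
qed

lemma open_contains_cyl:
  assumes "open U" "x \<in> U"
  shows "\<exists>n. \<forall>m\<ge>n. cyl (hist x m) \<subseteq> U"
proof -
  have "openin (product_topology (\<lambda>i. euclidean) UNIV) U"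
    using assms(1) by (simp add: open_fun_def)
  from product_topology_open_contains_basis[OF this assms(2)] obtain X where
    X: "x \<in> (\<Pi>\<^sub>E i\<in>UNIV. X i)" "finite {i. X i \<noteq> (UNIV :: bool set)}" "(\<Pi>\<^sub>E i\<in>UNIV. X i) \<subseteq> U"
    by auto
  obtain n where n: "\<And>i. X i \<noteq> UNIV \<Longrightarrow> i < n"
    using X(2) by (metis (mono_tags, lifting) finite_nat_set_iff_bounded mem_Collect_eq)
  have "y \<in> U" if "m \<ge> n" "y \<in> cyl (hist x m)" for y m
  proof -
    have "y i \<in> X i" for i
    proof (cases "i < n")
      case True
      then show ?thesis using that X(1) by (auto simp: cyl_hist PiE_iff)
    next
      case False
      then show ?thesis using n by blast
    qed
    then show ?thesis using X(3) by (auto simp: PiE_iff)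
  qed
  then show ?thesis by blast
qed

lemma open_contains_box:
  assumes "open U" "(x, y) \<in> U"
  shows "\<exists>n. \<forall>m\<ge>n. cyl (hist x m) \<times> cyl (hist y m) \<subseteq> U"
proof -
  obtain A B where AB: "open A" "open B" "x \<in> A" "y \<in> B" "A \<times> B \<subseteq> U"
    by (rule open_prod_elim[OF assms]) (auto intro: that)
  obtain n m where "\<And>k. k \<ge> n \<Longrightarrow> cyl (hist x k) \<subseteq> A" "\<And>k. k \<ge> m \<Longrightarrow> cyl (hist y k) \<subseteq> B"
    using open_contains_cyl[OF AB(1,3)] open_contains_cyl[OF AB(2,4)] by auto
  then have "cyl (hist x k) \<times> cyl (hist y k) \<subseteq> U" if "k \<ge> max n m" for k
    using that AB(5) by (meson Sigma_mono max.boundedE subset_trans)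
  then show ?thesis by blast
qed

lemma compact_cantor: "compact (UNIV :: (nat \<Rightarrow> bool) set)"
proof -
  have "compact_space (product_topology (\<lambda>_::nat. euclidean :: bool topology) UNIV)"
    unfolding compact_space_product_topology
    by (auto simp: compact_space_def finite_imp_compact)
  then show ?thesis
    by (simp add: euclidean_product_topology compact_space_def)
qed

lemma hausdorff_cantor_square:
  "Hausdorff_space (euclidean :: ((nat \<Rightarrow> bool) \<times> (nat \<Rightarrow> bool)) topology)"
proof -
  have "disjnt {x} {y}" if "x \<noteq> y" for x y :: bool
    using that by simp
  then have "Hausdorff_space (euclidean :: bool topology)"
    unfolding Hausdorff_space_def by (metis open_discrete open_openin singletonI)
  then have "Hausdorff_space (product_topology (\<lambda>_::nat. euclidean :: bool topology) UNIV)"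
    by (simp add: Hausdorff_space_product_topology)
  then have "Hausdorff_space (euclidean :: (nat \<Rightarrow> bool) topology)"
    by (simp add: euclidean_product_topology)
  then have "Hausdorff_space (prod_topology (euclidean :: (nat \<Rightarrow> bool) topology)
      (euclidean :: (nat \<Rightarrow> bool) topology))"
    by (simp add: Hausdorff_space_prod_topology del: prod_topology_euclidean)
  then show ?thesis by simp
qed

lemma comeager_cantor_square_dense:
  fixes C :: "((nat \<Rightarrow> bool) \<times> (nat \<Rightarrow> bool)) set"
  assumes "comeager C" "open U" "U \<noteq> {}"
  shows "C \<inter> U \<noteq> {}"
proof -
  obtain \<D> where \<D>: "countable \<D>" "\<And>D. D \<in> \<D> \<Longrightarrow> open D \<and> closure D = UNIV" "\<Inter>\<D> \<subseteq> C"
    using assms(1) unfolding comeager_def by blast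
  let ?X = "euclidean :: ((nat \<Rightarrow> bool) \<times> (nat \<Rightarrow> bool)) topology"
  have "compact (UNIV :: ((nat \<Rightarrow> bool) \<times> (nat \<Rightarrow> bool)) set)"
    using compact_Times[OF compact_cantor compact_cantor] by simp
  then have "compact_space ?X" by (simp add: compact_space_def)
  moreover have "Hausdorff_space ?X"
    using hausdorff_cantor_square .
  ultimately have "locally_compact_space ?X \<and> regular_space ?X"
    by (simp add: compact_imp_locally_compact_space compact_Hausdorff_imp_regular_space)
  then have "?X closure_of \<Inter>\<D> = topspace ?X"
    using \<D>(1,2) by (intro Baire_category) simp_all
  then have "closure (\<Inter>\<D>) = UNIV" by simp
  then show ?thesis
    using assms(3) \<D>(3) open_Int_closure_eq_empty[OF assms(2), of "\<Inter>\<D>"] by auto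
qed

lemma comeager_vimage_involution:
  fixes \<sigma> :: "'y::topological_space \<Rightarrow> 'y"
  assumes "comeager C" "continuous_on UNIV \<sigma>" "\<And>p. \<sigma> (\<sigma> p) = p"
  shows "comeager (\<sigma> -` C)"
proof -
  obtain \<D> where \<D>: "countable \<D>" "\<And>D. D \<in> \<D> \<Longrightarrow> open D \<and> closure D = UNIV" "\<Inter>\<D> \<subseteq> C"
    using assms(1) unfolding comeager_def by blast
  have op: "open (\<sigma> -` D)" if "open D" for D
    using that assms(2) by (rule open_vimage)
  have "closure (\<sigma> -` D) = UNIV" if "D \<in> \<D>" for D
  proof (rule ccontr)
    assume "closure (\<sigma> -` D) \<noteq> UNIV"
    then obtain p where p: "p \<in> - closure (\<sigma> -` D)" by blast
    let ?U = "\<sigma> -` (- closure (\<sigma> -` D))"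
    have "open ?U" by (intro op open_Compl closed_closure)
    moreover have "\<sigma> p \<in> ?U" using p assms(3) by simp
    ultimately have "?U \<inter> D \<noteq> {}"
      using \<D>(2)[OF that] open_Int_closure_eq_empty[of ?U D] by auto
    then obtain q where "q \<in> D" "\<sigma> q \<notin> closure (\<sigma> -` D)" by auto
    moreover have "\<sigma> q \<in> \<sigma> -` D" using \<open>q \<in> D\<close> assms(3) by simp
    ultimately show False using closure_subset[of "\<sigma> -` D"] by blast
  qed
  then have "\<forall>D\<in>(\<lambda>D. \<sigma> -` D) ` \<D>. open D \<and> closure D = UNIV"
    using \<D>(2) op by auto
  moreover have "\<Inter>((\<lambda>D. \<sigma> -` D) ` \<D>) \<subseteq> \<sigma> -` C" using \<D>(3) by auto
  ultimately show ?thesis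
    unfolding comeager_def using \<D>(1) by (intro exI[of _ "(\<lambda>D. \<sigma> -` D) ` \<D>"]) simp
qed

text \<open>Changing one coordinate is a homeomorphism, so a comeager set contains a pair together
  with the pair obtained by changing that coordinate.\<close>

lemma comeager_flip:
  assumes "comeager C"
  shows "\<exists>x\<in>cyl s. \<exists>y\<in>cyl t. (x, y) \<in> C \<and> (x(k := \<not> x k), y) \<in> C"
proof -
  define \<sigma> where "\<sigma> p = ((fst p)(k := \<not> fst p k), snd p)" for p :: "(nat \<Rightarrow> bool) \<times> (nat \<Rightarrow> bool)"
  have "continuous_on UNIV (\<lambda>x :: nat \<Rightarrow> bool. (x(k := \<not> x k)) i)" for i
    by (rule continuous_on_finitely_determined[of "Suc (max i k)"])
      (auto simp: hist_eq_iff less_Suc_eq_le simp del: hist.simps)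
  then have "continuous_on UNIV (\<lambda>x :: nat \<Rightarrow> bool. x(k := \<not> x k))"
    by (rule continuous_on_coordinatewise_then_product)
  then have "continuous_on UNIV \<sigma>"
    unfolding \<sigma>_def
    by (intro continuous_on_Pair continuous_on_snd continuous_on_id
      continuous_on_compose2[of UNIV "\<lambda>x. x(k := \<not> x k)" UNIV fst] continuous_on_fst subset_UNIV)
  moreover have "\<sigma> (\<sigma> p) = p" for p by (simp add: \<sigma>_def)
  ultimately have "comeager (C \<inter> \<sigma> -` C)"
    using assms by (intro comeager_Int comeager_vimage_involution)
  moreover have "open (cyl s \<times> cyl t)" by (intro open_Times open_cyl)
  ultimately have "(C \<inter> \<sigma> -` C) \<inter> (cyl s \<times> cyl t) \<noteq> {}"
    by (rule comeager_cantor_square_dense) (use cyl_nonempty in auto)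
  then show ?thesis unfolding \<sigma>_def by fastforce
qed

text \<open>One step of a fusion: the lists \<open>g i\<close> name cylinders, and finitely many requests ask for the box
  of the cylinders \<open>i\<close> and \<open>j\<close> to shrink into a dense open set. As \<open>i \<noteq> j\<close>, the two sides can be
  prolonged separately, one request after the other.\<close>

lemma shrink_to_dense_open:
  assumes "finite Q"
    and "\<And>i j D. (i, j, D) \<in> Q \<Longrightarrow> i \<noteq> j \<and> open D \<and> closure D = UNIV"
  shows "\<exists>g'. (\<forall>i. \<exists>w. g' i = w @ g i) \<and> (\<forall>(i, j, D)\<in>Q. cyl (g' i) \<times> cyl (g' j) \<subseteq> D)"
  using assms
proof (induction Q)
  case empty
  show ?case by (rule exI[of _ g]) simp
next
  case (insert q Q)
  obtain i j D where q: "q = (i, j, D)" by (cases q) auto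
  have D: "i \<noteq> j" "open D" "closure D = UNIV" using insert.prems[of i j D] q by auto
  have "\<exists>g'. (\<forall>i. \<exists>w. g' i = w @ g i) \<and> (\<forall>(i, j, D)\<in>Q. cyl (g' i) \<times> cyl (g' j) \<subseteq> D)"
    using insert.prems by (intro insert.IH) auto
  then obtain g' where g': "\<And>i. \<exists>w. g' i = w @ g i"
    "\<And>i j D. (i, j, D) \<in> Q \<Longrightarrow> cyl (g' i) \<times> cyl (g' j) \<subseteq> D"
    by fast
  have op: "open (cyl (g' i) \<times> cyl (g' j))" by (intro open_Times open_cyl)
  have "cyl (g' i) \<times> cyl (g' j) \<inter> D \<noteq> {}"
    using open_Int_closure_eq_empty[OF op, of D] D(3) cyl_nonempty by simp
  then obtain x y where xy: "x \<in> cyl (g' i)" "y \<in> cyl (g' j)" "(x, y) \<in> D" by auto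
  obtain n where n: "\<And>m. m \<ge> n \<Longrightarrow> cyl (hist x m) \<times> cyl (hist y m) \<subseteq> D"
    using open_contains_box[OF D(2) xy(3)] by blast
  define m where "m = max n (max (length (g' i)) (length (g' j)))"
  have m: "n \<le> m" "length (g' i) \<le> m" "length (g' j) \<le> m" by (auto simp: m_def)
  define g'' where "g'' = g'(i := hist x m, j := hist y m)"
  have ext: "\<exists>w. g'' k = w @ g' k" for k
    using hist_extends[OF xy(1) m(2)] hist_extends[OF xy(2) m(3)] by (auto simp: g''_def)
  then have sub: "cyl (g'' k) \<subseteq> cyl (g' k)" for k using cyl_append by metis
  have "\<exists>w. g'' k = w @ g k" for k using ext[of k] g'(1)[of k] by (metis append_assoc)
  moreover have "cyl (g'' i') \<times> cyl (g'' j') \<subseteq> D'" if "(i', j', D') \<in> insert q Q" for i' j' D'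
  proof (cases "(i', j', D') \<in> Q")
    case True
    then show ?thesis using g'(2)[of i' j' D'] sub[of i'] sub[of j'] by blast
  next
    case False
    then have "(i', j', D') = (i, j, D)" using that q by simp
    then show ?thesis using n[OF m(1)] D(1) by (simp add: g''_def)
  qed
  ultimately show ?case by (intro exI[of _ g'']) (metis (no_types, lifting) case_prodI2)
qed

text \<open>Mycielski's theorem. At stage \<open>n\<close> of the fusion, the finitely many off-diagonal boxes of level
  \<open>n + 1\<close> shrink into the dense open sets of index at most \<open>n\<close>. Distinct sequences differ from some
  level on, so their pair of images enters every one of the dense open sets.\<close>

lemma comeager_square_contains_cantor_square:
  fixes C :: "((nat \<Rightarrow> bool) \<times> (nat \<Rightarrow> bool)) set"
  assumes "comeager C"
  shows "\<exists>\<psi> :: (nat \<Rightarrow> bool) \<Rightarrow> (nat \<Rightarrow> bool). continuous_on UNIV \<psi> \<and>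
    (\<forall>x y. x \<noteq> y \<longrightarrow> (\<psi> x, \<psi> y) \<in> C)"
proof -
  obtain \<D> where \<D>: "countable \<D>" "\<forall>D\<in>\<D>. open D \<and> closure D = UNIV" "\<Inter>\<D> \<subseteq> C"
    using assms unfolding comeager_def by blast
  \<comment> \<open>An empty family has no enumeration, hence the additional full space.\<close>
  define D where "D = from_nat_into (insert UNIV \<D>)"
  have range_D: "range D = insert UNIV \<D>"
    unfolding D_def using \<D>(1) by (intro range_from_nat_into) auto
  then have D: "open (D i) \<and> closure (D i) = UNIV" for i
    using \<D>(2) by (metis closure_UNIV insertE open_UNIV rangeI)
  have "(\<Inter>i. D i) \<subseteq> C" using range_D \<D>(3) by auto
  define Step where "Step n g g' \<longleftrightarrow>
      (\<forall>b u. length u = n \<longrightarrow> (\<exists>w. g' (b # u) = w @ g u \<and> w \<noteq> [])) \<and>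
      (\<forall>u u' i. length u = Suc n \<and> length u' = Suc n \<and> u \<noteq> u' \<and> i \<le> n \<longrightarrow>
        cyl (g' u) \<times> cyl (g' u') \<subseteq> D i)"
    for n and g g' :: "bool list \<Rightarrow> bool list"
  have "\<exists>g'. Step n g g'" for n g
  proof -
    \<comment> \<open>The entry \<open>False\<close> only serves to make the lists grow.\<close>
    define h where "h u = (case u of [] \<Rightarrow> [] | b # u \<Rightarrow> False # g u)" for u :: "bool list"
    let ?L = "{u :: bool list. length u = Suc n}"
    define Q where "Q = {(u, u', D i) |u u' i. u \<in> ?L \<and> u' \<in> ?L \<and> u \<noteq> u' \<and> i \<le> n}"
    have "finite ?L" using finite_lists_length_eq[of "UNIV :: bool set" "Suc n"] by simp
    then have "finite (?L \<times> ?L \<times> D ` {..n})" by simp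
    moreover have "Q \<subseteq> ?L \<times> ?L \<times> D ` {..n}" unfolding Q_def by auto
    ultimately have "finite Q" by (rule rev_finite_subset)
    moreover have "u \<noteq> u' \<and> open E \<and> closure E = UNIV" if "(u, u', E) \<in> Q" for u u' E
      using that D by (auto simp: Q_def)
    ultimately have "\<exists>g'. (\<forall>u. \<exists>w. g' u = w @ h u) \<and>
        (\<forall>(u, u', E)\<in>Q. cyl (g' u) \<times> cyl (g' u') \<subseteq> E)"
      by (rule shrink_to_dense_open)
    then obtain g' where g': "\<And>u. \<exists>w. g' u = w @ h u"
        "\<forall>(u, u', E)\<in>Q. cyl (g' u) \<times> cyl (g' u') \<subseteq> E"
      by blast
    have s1: "\<exists>w. g' (b # u) = w @ g u \<and> w \<noteq> []" for b u
    proof -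
      obtain w where "g' (b # u) = w @ h (b # u)" using g'(1) by blast
      then have "g' (b # u) = (w @ [False]) @ g u" by (simp add: h_def)
      then show ?thesis by blast
    qed
    have s2: "cyl (g' u) \<times> cyl (g' u') \<subseteq> D i"
      if "length u = Suc n" "length u' = Suc n" "u \<noteq> u'" "i \<le> n" for u u' i
    proof -
      have "(u, u', D i) \<in> Q" using that by (auto simp: Q_def)
      then show ?thesis using g'(2) by fast
    qed
    show ?thesis
      unfolding Step_def by (intro exI[of _ g'] conjI allI impI s1 s2) simp_all
  qed
  then obtain G where G: "\<And>n. Step n (G n) (G (Suc n))"
    using dependent_nat_choice[of "\<lambda>_ _. True" Step] by auto
  define c where "c x n = G n (hist x n)" for x n
  have "\<exists>w. c x (Suc n) = w @ c x n \<and> w \<noteq> []" for x n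
    using G[of n] by (simp add: Step_def c_def)
  then have "\<exists>z. \<forall>n. z \<in> cyl (c x n)" for x
    by (rule nested_cyl_nonempty)
  then obtain \<psi> where \<psi>: "\<And>x n. \<psi> x \<in> cyl (c x n)" by metis
  have len: "n \<le> length (c x n)" for x n
  proof (induction n)
    case (Suc n)
    obtain w where "c x (Suc n) = w @ c x n" "w \<noteq> []"
      using \<open>\<And>x n. \<exists>w. c x (Suc n) = w @ c x n \<and> w \<noteq> []\<close> by blast
    then have "length (c x n) < length (c x (Suc n))" by simp
    with Suc show ?case by linarith
  qed simp
  have "continuous_on UNIV (\<lambda>x. \<psi> x i)" for i
  proof (rule continuous_on_finitely_determined[of "Suc i"])
    fix x y assume "hist x (Suc i) = hist y (Suc i)"
    then have "c x (Suc i) = c y (Suc i)" by (simp only: c_def)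
    then show "\<psi> x i = \<psi> y i"
      using \<psi>[of x "Suc i"] \<psi>[of y "Suc i"] len[of "Suc i" x] by (intro cyl_agree) auto
  qed
  then have "continuous_on UNIV \<psi>" by (rule continuous_on_coordinatewise_then_product)
  moreover have "(\<psi> x, \<psi> y) \<in> C" if "x \<noteq> y" for x y
  proof -
    obtain j where j: "x j \<noteq> y j" using \<open>x \<noteq> y\<close> by blast
    have "(\<psi> x, \<psi> y) \<in> D i" for i
    proof -
      define n where "n = max i j"
      have n: "i \<le> n" "j < Suc n" by (auto simp: n_def)
      then have "hist x (Suc n) \<noteq> hist y (Suc n)"
        unfolding hist_eq_iff using j by blast
      with n(1) have "cyl (c x (Suc n)) \<times> cyl (c y (Suc n)) \<subseteq> D i"
        using G[of n] unfolding Step_def c_def by (metis length_hist)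
      then show ?thesis using \<psi> by blast
    qed
    then show ?thesis using \<open>(\<Inter>i. D i) \<subseteq> C\<close> by blast
  qed
  ultimately show ?thesis by (intro exI[of _ \<psi>]) simp
qed

section \<open>A continuous homomorphism out of a sparse acyclic graph\<close>

text \<open>The graph in question lives on the Cantor space: its edges join \<open>x\<close> to \<open>x(k := True)\<close>
  whenever \<open>x\<close> passes through \<open>split_node k\<close> and then takes the value \<^term>\<open>False\<close>. There is one such
  node on each level, which makes the graph acyclic, and every list is an initial segment of a node.
  For the latter, the index codes the list together with a number that can be chosen to make the
  level large enough for it.\<close>

definition split_node :: "nat \<Rightarrow> bool list"
  where "split_node k = (let t = from_nat (fst (prod_decode k)) in
    if length t \<le> k then replicate (k - length t) False @ t else replicate k False)"

lemma length_split_node [simp]: "length (split_node k) = k"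
  by (simp add: split_node_def Let_def)

lemma split_node_dense: "\<exists>k w. split_node k = w @ t"
proof -
  define k where "k = prod_encode (to_nat t, length t)"
  have "length t \<le> k" unfolding k_def by (rule le_prod_encode_2)
  then show ?thesis
    by (intro exI[of _ k] exI[of _ "replicate (k - length t) False"])
      (simp add: split_node_def k_def Let_def)
qed

definition independent_set :: "('a \<times> 'a) set \<Rightarrow> 'a set \<Rightarrow> bool"
  where "independent_set R A \<longleftrightarrow> (\<forall>x\<in>A. \<forall>y\<in>A. (x, y) \<notin> R)"

text \<open>A copy of level \<open>n\<close> places the lists of length \<open>n\<close> in the space and carries for each edge
  between them a witness in the Baire space. An edge is determined by what follows the splitting,
  which makes the witnesses a labelling of the lists shorter than \<open>n\<close>.\<close>

type_synonym 'a copy = "(bool list \<Rightarrow> 'a) \<times> (bool list \<Rightarrow> (nat \<Rightarrow> nat))"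

definition copies :: "(('a \<times> 'a) \<times> (nat \<Rightarrow> nat)) set \<Rightarrow> nat \<Rightarrow> 'a copy set"
  where "copies F n = {p. \<forall>u k. length u + Suc k = n \<longrightarrow>
    ((fst p (u @ False # split_node k), fst p (u @ True # split_node k)), snd p u) \<in> F}"

text \<open>A negligible set of copies is caught by countably many independent sets, each of them tied to
  the vertex that it catches. On level \<open>0\<close>, where a copy is a point, this is a countable cover by
  independent sets.\<close>

definition negligible :: "('a \<times> 'a) set \<Rightarrow> nat \<Rightarrow> 'a copy set \<Rightarrow> bool"
  where "negligible R n H \<longleftrightarrow> (\<exists>\<C>. countable \<C> \<and>
    (\<forall>c\<in>\<C>. length (fst c) = n \<and> independent_set R (snd c)) \<and>
    (\<forall>p\<in>H. \<exists>c\<in>\<C>. fst p (fst c) \<in> snd c))"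

lemma negligible_UN:
  assumes "countable I" "\<And>i. i \<in> I \<Longrightarrow> negligible R n (H i)"
  shows "negligible R n (\<Union>i\<in>I. H i)"
proof -
  obtain \<C> where \<C>: "\<And>i. i \<in> I \<Longrightarrow> countable (\<C> i) \<and>
      (\<forall>c\<in>\<C> i. length (fst c) = n \<and> independent_set R (snd c)) \<and>
      (\<forall>p\<in>H i. \<exists>c\<in>\<C> i. fst p (fst c) \<in> snd c)"
    using assms(2) unfolding negligible_def by metis
  have "countable (\<Union>i\<in>I. \<C> i)" using assms(1) \<C> by (intro countable_UN) auto
  moreover have "\<forall>c\<in>(\<Union>i\<in>I. \<C> i). length (fst c) = n \<and> independent_set R (snd c)"
    using \<C> by blast
  moreover have "\<exists>c\<in>(\<Union>i\<in>I. \<C> i). fst p (fst c) \<in> snd c" if "p \<in> (\<Union>i\<in>I. H i)" for p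
  proof -
    from that obtain i where i: "i \<in> I" "p \<in> H i" by blast
    then obtain c where "c \<in> \<C> i" "fst p (fst c) \<in> snd c" using \<C>[OF i(1)] by blast
    with i(1) show ?thesis by blast
  qed
  ultimately show ?thesis unfolding negligible_def by (intro exI[of _ "\<Union>i\<in>I. \<C> i"]) simp
qed

lemma not_negligible_fibre:
  fixes f :: "'a copy \<Rightarrow> 'c::countable"
  assumes "\<not> negligible R n H"
  shows "\<exists>a. \<not> negligible R n {p \<in> H. f p = a}"
proof (rule ccontr)
  assume "\<nexists>a. \<not> negligible R n {p \<in> H. f p = a}"
  then have "negligible R n (\<Union>a\<in>UNIV. {p \<in> H. f p = a})"
    by (intro negligible_UN) auto
  moreover have "(\<Union>a\<in>UNIV. {p \<in> H. f p = a}) = H" by auto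
  ultimately show False using assms by simp
qed

text \<open>Two copies side by side, the latest entry of a list telling which of them to use. The empty list
  names the edge between the two halves.\<close>

definition join :: "'a copy \<Rightarrow> 'a copy \<Rightarrow> (nat \<Rightarrow> nat) \<Rightarrow> 'a copy"
  where "join p q z =
    (\<lambda>u. fst (if hd u then q else p) (tl u),
     \<lambda>u. if u = [] then z else snd (if hd u then q else p) (tl u))"

definition extensions :: "(('a \<times> 'a) \<times> (nat \<Rightarrow> nat)) set \<Rightarrow> nat \<Rightarrow> 'a copy set \<Rightarrow> 'a copy set"
  where "extensions F n H = {join p q z |p q z. p \<in> H \<and> q \<in> H \<and>
    ((fst p (split_node n), fst q (split_node n)), z) \<in> F}"

lemma extensions_subset_copies:
  assumes "H \<subseteq> copies F n"
  shows "extensions F n H \<subseteq> copies F (Suc n)"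
proof
  fix r assume "r \<in> extensions F n H"
  then obtain p q z where r: "r = join p q z" and pq: "p \<in> copies F n" "q \<in> copies F n"
    and z: "((fst p (split_node n), fst q (split_node n)), z) \<in> F"
    using assms unfolding extensions_def by blast
  have "((fst r (u @ False # split_node k), fst r (u @ True # split_node k)), snd r u) \<in> F"
    if "length u + Suc k = Suc n" for u k
  proof (cases u)
    case Nil
    then show ?thesis using that z by (simp add: r join_def)
  next
    case (Cons b u')
    then have "length u' + Suc k = n" using that by simp
    then show ?thesis using pq Cons by (cases b) (simp_all add: r join_def copies_def)
  qed
  then show "r \<in> copies F (Suc n)" by (simp add: copies_def)
qed

text \<open>Remove from \<open>H\<close> the copies that have a vertex in one of the independent sets catching the
  extensions. What remains is not negligible, so its vertices at the splitting node do not form an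
  independent set. An edge between two of them yields an extension that is not caught.\<close>

lemma extensions_not_negligible:
  assumes "\<not> negligible (fst ` F) n H"
  shows "\<not> negligible (fst ` F) (Suc n) (extensions F n H)"
proof
  let ?R = "fst ` F"
  assume "negligible ?R (Suc n) (extensions F n H)"
  then obtain \<C> where \<C>: "countable \<C>"
      "\<And>c. c \<in> \<C> \<Longrightarrow> length (fst c) = Suc n \<and> independent_set ?R (snd c)"
      "\<And>p. p \<in> extensions F n H \<Longrightarrow> \<exists>c\<in>\<C>. fst p (fst c) \<in> snd c"
    unfolding negligible_def by blast
  define \<C>' where "\<C>' = (\<lambda>c. (tl (fst c), snd c)) ` \<C>"
  have \<C>': "countable \<C>'" "\<And>c. c \<in> \<C>' \<Longrightarrow> length (fst c) = n \<and> independent_set ?R (snd c)"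
    using \<C>(1,2) by (auto simp: \<C>'_def)
  define H0 where "H0 = {p \<in> H. \<forall>c\<in>\<C>'. fst p (fst c) \<notin> snd c}"
  define A where "A = (\<lambda>p. fst p (split_node n)) ` H0"
  have "\<not> independent_set ?R A"
  proof
    assume ind: "independent_set ?R A"
    let ?\<C> = "insert (split_node n, A) \<C>'"
    have "\<exists>c\<in>?\<C>. fst p (fst c) \<in> snd c" if "p \<in> H" for p
      using that by (cases "p \<in> H0") (auto simp: H0_def A_def)
    moreover have "\<forall>c\<in>?\<C>. length (fst c) = n \<and> independent_set ?R (snd c)"
      using \<C>'(2) ind by auto
    ultimately have "negligible ?R n H"
      unfolding negligible_def using \<C>'(1) by (intro exI[of _ ?\<C>]) simp
    with assms show False ..
  qed
  then obtain p q z where pq: "p \<in> H0" "q \<in> H0"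
      and z: "((fst p (split_node n), fst q (split_node n)), z) \<in> F"
    unfolding independent_set_def A_def by auto
  then have "join p q z \<in> extensions F n H"
    unfolding extensions_def H0_def by blast
  then obtain c where c: "c \<in> \<C>" "fst (join p q z) (fst c) \<in> snd c" using \<C>(3) by blast
  then have c': "(tl (fst c), snd c) \<in> \<C>'" by (auto simp: \<C>'_def)
  have "fst (if hd (fst c) then q else p) (tl (fst c)) \<in> snd c"
    using c(2) by (simp add: join_def)
  moreover have "(if hd (fst c) then q else p) \<in> H0" using pq by simp
  ultimately show False using c' unfolding H0_def by fastforce
qed

lemma countable_colouring_small:
  assumes "\<epsilon> > 0"
  shows "\<exists>g :: 'a::{metric_space, second_countable_topology} \<Rightarrow> nat.
    \<forall>x y. g x = g y \<longrightarrow> dist x y < \<epsilon>"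
proof -
  obtain D :: "'a set" where D: "countable D" "\<And>X. open X \<Longrightarrow> X \<noteq> {} \<Longrightarrow> \<exists>d\<in>D. d \<in> X"
    by (rule countable_dense_setE) blast
  have "\<exists>d\<in>D. dist x d < \<epsilon> / 2" for x
    using D(2)[of "ball x (\<epsilon> / 2)"] assms by auto
  then obtain d where d: "\<And>x. d x \<in> D \<and> dist x (d x) < \<epsilon> / 2" by metis
  have "dist x y < \<epsilon>" if "to_nat_on D (d x) = to_nat_on D (d y)" for x y
  proof -
    have "d x = d y" using that d D(1) by (meson inj_on_to_nat_on inj_onD)
    then show ?thesis using d[of x] d[of y] dist_triangle_half_l[of x "d x" \<epsilon> y] by simp
  qed
  then show ?thesis by (intro exI[of _ "\<lambda>x. to_nat_on D (d x)"]) blast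
qed

definition narrow :: "nat \<Rightarrow> 'a::metric_space copy set \<Rightarrow> bool"
  where "narrow n H \<longleftrightarrow> (\<forall>p\<in>H. \<forall>q\<in>H.
    (\<forall>u. length u = n \<longrightarrow> dist (fst p u) (fst q u) < (1/2) ^ n) \<and>
    (\<forall>u. length u < n \<longrightarrow> (\<forall>i<n. snd p u i = snd q u i)))"

lemma narrow_dist:
  "narrow n H \<Longrightarrow> p \<in> H \<Longrightarrow> q \<in> H \<Longrightarrow> length u = n \<Longrightarrow> dist (fst p u) (fst q u) < (1/2) ^ n"
  unfolding narrow_def by blast

lemma narrow_agree:
  "narrow n H \<Longrightarrow> p \<in> H \<Longrightarrow> q \<in> H \<Longrightarrow> length u < n \<Longrightarrow> i < n \<Longrightarrow> snd p u i = snd q u i"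
  unfolding narrow_def by blast

text \<open>A copy has finitely many vertices and witnesses. Up to the required precision there are
  countably many possibilities for them, and countable unions of negligible sets are negligible.\<close>

lemma not_negligible_narrow_subset:
  fixes H :: "'a::{metric_space, second_countable_topology} copy set"
  assumes "\<not> negligible R n H"
  shows "\<exists>H'\<subseteq>H. \<not> negligible R n H' \<and> narrow n H'"
proof -
  obtain g :: "'a \<Rightarrow> nat" where g: "\<And>x y. g x = g y \<Longrightarrow> dist x y < (1/2) ^ n"
    using countable_colouring_small[of "(1/2) ^ n"] by auto
  define V where "V m = List.n_lists m [False, True]" for m
  have V: "set (V m) = {u. length u = m}" for m
    by (auto simp: V_def set_n_lists)
  define f where "f p = (map (\<lambda>u. g (fst p u)) (V n),
      map (\<lambda>u. map (snd p u) [0..<n]) (concat (map V [0..<n])))" for p :: "'a copy"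
  obtain a where a: "\<not> negligible R n {p \<in> H. f p = a}"
    using not_negligible_fibre[OF assms] by blast
  have "narrow n {p \<in> H. f p = a}"
    unfolding narrow_def
  proof (intro ballI conjI allI impI)
    fix p q assume "p \<in> {p \<in> H. f p = a}" "q \<in> {p \<in> H. f p = a}"
    then have eq: "f p = f q" by simp
    show "dist (fst p u) (fst q u) < (1/2) ^ n" if "length u = n" for u
      using eq that by (intro g) (simp add: f_def V)
    show "snd p u i = snd q u i" if "length u < n" "i < n" for u i
      using eq that by (simp add: f_def V)
  qed
  with a show ?thesis by (intro exI[of _ "{p \<in> H. f p = a}"]) auto
qed

lemma geometric_sequence_limit:
  fixes y :: "nat \<Rightarrow> 'a::complete_space"
  assumes "\<And>n. dist (y (Suc n)) (y n) < (1/2) ^ n"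
  shows "\<exists>l. y \<longlonglongrightarrow> l \<and> (\<forall>n. dist l (y n) \<le> 2 * (1/2) ^ n)"
proof -
  have "dist (y (n + m)) (y n) \<le> 2 * (1/2) ^ n - 2 * (1/2) ^ (n + m)" for n m
  proof (induction m)
    case (Suc m)
    have "dist (y (n + Suc m)) (y n) \<le> dist (y (Suc (n + m))) (y (n + m)) + dist (y (n + m)) (y n)"
      using dist_triangle by simp
    also have "\<dots> \<le> (1/2) ^ (n + m) + (2 * (1/2) ^ n - 2 * (1/2) ^ (n + m))"
      using assms[of "n + m"] Suc by linarith
    finally show ?case by simp
  qed simp
  then have bd: "dist (y m) (y n) \<le> 2 * (1/2) ^ n" if "n \<le> m" for n m
    using le_Suc_ex[OF that] by (smt (verit) zero_le_power divide_nonneg_nonneg)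
  have "Cauchy y"
  proof (rule metric_CauchyI)
    fix e :: real assume "e > 0"
    then obtain n where n: "(1/2) ^ n < e / 4"
      using real_arch_pow_inv[of "e / 4" "1/2"] by auto
    have "dist (y m) (y k) < e" if "m \<ge> n" "k \<ge> n" for m k
      using bd[OF that(1)] bd[OF that(2)] dist_triangle2[of "y m" "y k" "y n"] n by linarith
    then show "\<exists>M. \<forall>m\<ge>M. \<forall>k\<ge>M. dist (y m) (y k) < e" by blast
  qed
  then have "convergent y" by (rule Cauchy_convergent)
  then obtain l where l: "y \<longlonglongrightarrow> l" unfolding convergent_def by blast
  have "dist l (y n) \<le> 2 * (1/2) ^ n" for n
  proof (rule Lim_bounded[where f = "\<lambda>m. dist (y m) (y n)" and M = n])
    show "(\<lambda>m. dist (y m) (y n)) \<longlonglongrightarrow> dist l (y n)" by (intro tendsto_dist l tendsto_const)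
  qed (use bd in auto)
  with l show ?thesis by blast
qed

lemma eventually_constant_entries_tendsto:
  fixes z :: "nat \<Rightarrow> nat \<Rightarrow> nat"
  assumes "\<And>m i. i \<le> m \<Longrightarrow> z (Suc m) i = z m i"
  shows "z \<longlonglongrightarrow> (\<lambda>i. z i i)"
proof -
  have "z m i = z i i" if "i \<le> m" for m i
    using that by (induction m rule: dec_induct) (use assms in auto)
  then have "eventually (\<lambda>m. z m i = z i i) sequentially" for i
    unfolding eventually_sequentially by blast
  then have "(\<lambda>m. z m i) \<longlonglongrightarrow> z i i" for i
    by (rule tendsto_eventually)
  then have "limitin (product_topology (\<lambda>_. euclidean) UNIV) z (\<lambda>i. z i i) sequentially"
    by (subst limitin_componentwise) simp
  then show ?thesis by (simp add: euclidean_product_topology)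
qed

text \<open>The Cantor scheme of copies: each non-negligible set of copies is extended and then narrowed.
  Vertices converge by narrowness, and so do the witnesses of every edge; as \<open>F\<close> is closed, the
  limits of the edges are edges again.\<close>

lemma continuous_homomorphism:
  fixes F :: "(('a::polish_space \<times> 'a) \<times> (nat \<Rightarrow> nat)) set"
  assumes "closed F"
    and uncov: "\<And>\<A>. countable \<A> \<Longrightarrow> (\<And>A. A \<in> \<A> \<Longrightarrow> independent_set (fst ` F) A) \<Longrightarrow> \<Union>\<A> \<noteq> UNIV"
  shows "\<exists>\<phi>. continuous_on UNIV \<phi> \<and>
    (\<forall>k x. hist x k = split_node k \<longrightarrow> \<not> x k \<longrightarrow> (\<phi> x, \<phi> (x(k := True))) \<in> fst ` F)"
proof -
  let ?R = "fst ` F"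
  have "\<not> negligible ?R 0 (copies F 0)"
  proof
    assume "negligible ?R 0 (copies F 0)"
    then obtain \<C> where \<C>: "countable \<C>"
        "\<And>c. c \<in> \<C> \<Longrightarrow> length (fst c) = 0 \<and> independent_set ?R (snd c)"
        "\<And>p. p \<in> copies F 0 \<Longrightarrow> \<exists>c\<in>\<C>. fst p (fst c) \<in> snd c"
      unfolding negligible_def by blast
    have "\<exists>A\<in>snd ` \<C>. a \<in> A" for a
    proof -
      have "(\<lambda>_. a, \<lambda>_ _. 0) \<in> copies F 0" by (simp add: copies_def)
      from \<C>(3)[OF this] show ?thesis by auto
    qed
    then have "\<Union>(snd ` \<C>) = UNIV" by blast
    moreover have "independent_set ?R A" if "A \<in> snd ` \<C>" for A using that \<C>(2) by blast
    ultimately show False using uncov[of "snd ` \<C>"] \<C>(1) by blast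
  qed
  then obtain H0 where H0: "H0 \<subseteq> copies F 0" "\<not> negligible ?R 0 H0" "narrow 0 H0"
    using not_negligible_narrow_subset by blast
  have "\<exists>H. \<forall>n. (H n \<subseteq> copies F n \<and> \<not> negligible ?R n (H n) \<and> narrow n (H n)) \<and>
      H (Suc n) \<subseteq> extensions F n (H n)"
  proof (rule dependent_nat_choice)
    fix H n assume H: "H \<subseteq> copies F n \<and> \<not> negligible ?R n H \<and> narrow n H"
    then have "\<not> negligible ?R (Suc n) (extensions F n H)"
      by (intro extensions_not_negligible) simp
    then obtain H' where "H' \<subseteq> extensions F n H" "\<not> negligible ?R (Suc n) H'" "narrow (Suc n) H'"
      using not_negligible_narrow_subset by blast
    moreover have "extensions F n H \<subseteq> copies F (Suc n)"
      using H by (intro extensions_subset_copies) simp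
    ultimately show "\<exists>H'. (H' \<subseteq> copies F (Suc n) \<and> \<not> negligible ?R (Suc n) H' \<and>
        narrow (Suc n) H') \<and> H' \<subseteq> extensions F n H"
      by blast
  qed (use H0 in blast)
  then obtain H where copies: "\<And>n. H n \<subseteq> copies F n" and large: "\<And>n. \<not> negligible ?R n (H n)"
    and narrow: "\<And>n. narrow n (H n)" and ext: "\<And>n. H (Suc n) \<subseteq> extensions F n (H n)"
    by blast
  have "H n \<noteq> {}" for n
    using large[of n] unfolding negligible_def by (auto intro: exI[of _ "{}"])
  then have "\<forall>n. \<exists>p. p \<in> H n" by blast
  then obtain p where p: "\<And>n. p n \<in> H n" by metis
  have near: "dist (fst (p (Suc n)) (b # u)) (fst (p n) u) < (1/2) ^ n" if "length u = n" for n b u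
  proof -
    obtain q q' z where q: "p (Suc n) = join q q' z" "q \<in> H n" "q' \<in> H n"
      using p[of "Suc n"] ext[of n] unfolding extensions_def by blast
    then have "fst (p (Suc n)) (b # u) = fst (if b then q' else q) u" by (simp add: join_def)
    moreover have "(if b then q' else q) \<in> H n" using q(2,3) by simp
    note narrow_dist[OF narrow this p that]
    ultimately show ?thesis by (simp only:)
  qed
  have agree: "snd (p (Suc n)) (b # u) i = snd (p n) u i" if "length u < n" "i < n" for n b u i
  proof -
    obtain q q' z where q: "p (Suc n) = join q q' z" "q \<in> H n" "q' \<in> H n"
      using p[of "Suc n"] ext[of n] unfolding extensions_def by blast
    then have "snd (p (Suc n)) (b # u) = snd (if b then q' else q) u" by (simp add: join_def)
    moreover have "(if b then q' else q) \<in> H n" using q(2,3) by simp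
    note narrow_agree[OF narrow this p that]
    ultimately show ?thesis by (simp only:)
  qed
  have "\<exists>l. (\<lambda>n. fst (p n) (hist x n)) \<longlonglongrightarrow> l \<and>
      (\<forall>n. dist l (fst (p n) (hist x n)) \<le> 2 * (1/2) ^ n)" for x
    by (rule geometric_sequence_limit) (simp add: near)
  then obtain \<phi> where lim: "\<And>x. (\<lambda>n. fst (p n) (hist x n)) \<longlonglongrightarrow> \<phi> x"
    and bd: "\<And>x n. dist (\<phi> x) (fst (p n) (hist x n)) \<le> 2 * (1/2) ^ n"
    by metis
  have "(\<phi> \<longlongrightarrow> \<phi> x) (at x)" for x
  proof (rule tendstoI)
    fix e :: real assume "e > 0"
    then obtain n where n: "(1/2) ^ n < e / 4"
      using real_arch_pow_inv[of "e / 4" "1/2"] by auto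
    have "dist (\<phi> y) (\<phi> x) < e" if "y \<in> cyl (hist x n)" for y
    proof -
      have "hist y n = hist x n" using that by (simp add: cyl_def)
      then show ?thesis
        using bd[of x n] bd[of y n] n
          dist_triangle2[of "\<phi> y" "\<phi> x" "fst (p n) (hist x n)"] by simp
    qed
    then show "\<forall>\<^sub>F y in at x. dist (\<phi> y) (\<phi> x) < e"
      unfolding eventually_at_topological using open_cyl[of "hist x n"] mem_cyl_hist by blast
  qed
  then have "continuous_on UNIV \<phi>"
    by (simp add: continuous_on_def)
  moreover have "(\<phi> x, \<phi> (x(k := True))) \<in> ?R" if x: "hist x k = split_node k" "\<not> x k" for k x
  proof -
    define y where "y = x(k := True)"
    define t where "t i = x (Suc k + i)" for i
    define z where "z m = snd (p (Suc k + m)) (hist t m)" for m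
    have "hist y k = split_node k" using x(1) by (simp add: y_def hist_eq_iff flip: x(1))
    moreover have "hist (\<lambda>i. y (Suc k + i)) m = hist t m" for m
      by (simp add: hist_eq_iff t_def y_def)
    ultimately have hy: "hist y (Suc k + m) = hist t m @ True # split_node k" for m
      by (subst hist_add) (simp add: y_def)
    have "hist (\<lambda>i. x (Suc k + i)) m = hist t m" for m
      by (simp add: hist_eq_iff t_def)
    then have hx: "hist x (Suc k + m) = hist t m @ False # split_node k" for m
      using x by (subst hist_add) simp
    have "z (Suc m) i = z m i" if "i \<le> m" for m i
      unfolding z_def using agree[of "hist t m" "Suc k + m" i "t m"] that by simp
    then have z: "z \<longlonglongrightarrow> (\<lambda>i. z i i)" by (rule eventually_constant_entries_tendsto)
    have sub: "(\<lambda>m. fst (p (Suc k + m)) (hist w (Suc k + m))) \<longlonglongrightarrow> \<phi> w" for w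
      using LIMSEQ_ignore_initial_segment[OF lim[of w], of "Suc k"] by (simp only: add.commute)
    have conv: "(\<lambda>m. ((fst (p (Suc k + m)) (hist x (Suc k + m)),
        fst (p (Suc k + m)) (hist y (Suc k + m))), z m)) \<longlonglongrightarrow> ((\<phi> x, \<phi> y), \<lambda>i. z i i)"
      by (intro tendsto_Pair sub z)
    have mem: "((fst (p (Suc k + m)) (hist x (Suc k + m)),
        fst (p (Suc k + m)) (hist y (Suc k + m))), z m) \<in> F" for m
    proof -
      have "p (Suc k + m) \<in> copies F (Suc k + m)" using p copies by blast
      then have "((fst (p (Suc k + m)) (hist t m @ False # split_node k),
          fst (p (Suc k + m)) (hist t m @ True # split_node k)), snd (p (Suc k + m)) (hist t m)) \<in> F"
        unfolding copies_def by simp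
      then show ?thesis by (simp only: hx hy z_def)
    qed
    have "((\<phi> x, \<phi> y), \<lambda>i. z i i) \<in> F"
      by (rule closed_sequentially[OF assms(1) mem conv])
    then show ?thesis unfolding y_def by force
  qed
  ultimately show ?thesis by blast
qed

section \<open>Perfectly many classes\<close>

lemma perfect_set_range:
  fixes h :: "(nat \<Rightarrow> bool) \<Rightarrow> 'a::metric_space"
  assumes "continuous_on UNIV h" "inj h"
  shows "perfect_set (range h)"
  unfolding perfect_set_def
proof (intro conjI ballI)
  have "compact (range h)" using assms(1) compact_cantor by (rule compact_continuous_image)
  then show "closed (range h)" by (rule compact_imp_closed)
next
  fix a assume "a \<in> range h"
  then obtain x where a: "a = h x" by blast
  show "a islimpt range h"
  proof (rule islimptI)
    fix T assume T: "a \<in> T" "open T"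
    have "open (h -` T)" using T(2) assms(1) by (rule open_vimage)
    moreover have "x \<in> h -` T" using T(1) a by simp
    ultimately obtain n where n: "cyl (hist x n) \<subseteq> h -` T"
      using open_contains_cyl[of "h -` T" x] by blast
    define y where "y = x(n := \<not> x n)"
    have "y \<in> cyl (hist x n)" by (simp add: cyl_hist y_def)
    then have "h y \<in> T" using n by blast
    moreover have "y \<noteq> x" unfolding y_def by (metis fun_upd_same)
    then have "h y \<noteq> a" using assms(2) a by (metis injD)
    ultimately show "\<exists>b\<in>range h. b \<in> T \<and> b \<noteq> a" by blast
  qed
qed simp

text \<open>The members of an independent set that lie in \<open>B\<close> are pairwise equivalent.\<close>

lemma class_ideal_independent_cover:
  assumes "countable \<A>" "\<And>A. A \<in> \<A> \<Longrightarrow> independent_set (B \<times> B - E) A" "\<Union>\<A> = UNIV"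
  shows "B \<in> class_ideal E"
proof -
  define b where "b A = (SOME x. x \<in> A \<inter> B)" for A
  let ?\<C> = "(\<lambda>A. E `` {b A}) ` \<A>"
  have "x \<in> \<Union>?\<C>" if "x \<in> B" for x
  proof -
    have "x \<in> \<Union>\<A>" using assms(3) by simp
    then obtain A where A: "A \<in> \<A>" "x \<in> A" by blast
    have "b A \<in> A \<inter> B"
      unfolding b_def by (rule someI[of "\<lambda>x. x \<in> A \<inter> B" x]) (use A(2) that in simp)
    then have "(b A, x) \<in> E"
      using assms(2)[OF A(1)] A(2) that unfolding independent_set_def by blast
    then show ?thesis using A(1) by blast
  qed
  then have "B \<subseteq> \<Union>?\<C>" by blast
  moreover have "?\<C> \<subseteq> UNIV // E" by (auto intro: quotientI)
  moreover have "countable ?\<C>" using assms(1) by simp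
  ultimately show ?thesis unfolding class_ideal_def by blast
qed

text \<open>If the relation were nonmeager, it would contain a comeager part of a box, and the box may be
  shrunk so that its first side is the cylinder of some \<^term>\<open>split_node k\<close>. Changing the first
  sequence of a pair at position \<open>k\<close> then leads to a pair that is generic as well, hence to two
  equivalent sequences joined by an edge.\<close>

lemma equivalence_avoiding_edges_meager:
  fixes E :: "((nat \<Rightarrow> bool) \<times> (nat \<Rightarrow> bool)) set"
  assumes "baire_property E" "sym E" "trans E"
    and edge: "\<And>k x. hist x k = split_node k \<Longrightarrow> \<not> x k \<Longrightarrow> (x, x(k := True)) \<notin> E"
  shows "comeager (- E)"
proof -
  obtain U where U: "open U" "comeager {p. p \<in> E \<longleftrightarrow> p \<in> U}"
    using assms(1) unfolding baire_property_def by blast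
  have "U = {}"
  proof (rule ccontr)
    assume "U \<noteq> {}"
    then obtain x0 y0 where "(x0, y0) \<in> U" by auto
    then obtain n where n: "cyl (hist x0 n) \<times> cyl (hist y0 n) \<subseteq> U"
      using open_contains_box[OF U(1)] by blast
    obtain k w where k: "split_node k = w @ hist x0 n" using split_node_dense by blast
    have sub: "cyl (split_node k) \<times> cyl (hist y0 n) \<subseteq> U"
      using n k cyl_append[of w "hist x0 n"] by auto
    obtain x y where xy: "x \<in> cyl (split_node k)" "y \<in> cyl (hist y0 n)"
        "(x, y) \<in> {p. p \<in> E \<longleftrightarrow> p \<in> U}" "(x(k := \<not> x k), y) \<in> {p. p \<in> E \<longleftrightarrow> p \<in> U}"
      using comeager_flip[OF U(2), of "split_node k" "hist y0 n" k] by blast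
    have hx: "hist x k = split_node k" using xy(1) by (simp add: cyl_def)
    have upd: "hist (x(k := c)) k = split_node k" for c
      unfolding hx[symmetric] by (simp add: hist_eq_iff)
    then have "x(k := \<not> x k) \<in> cyl (split_node k)" by (simp add: cyl_def)
    then have "(x, y) \<in> E" "(x(k := \<not> x k), y) \<in> E" using xy sub by auto
    then have E: "(x, x(k := \<not> x k)) \<in> E" "(x(k := \<not> x k), x) \<in> E"
      using assms(2,3) by (meson symE transE)+
    show False
    proof (cases "x k")
      case True
      then have "(x(k := False), (x(k := False))(k := True)) \<notin> E"
        by (intro edge upd) simp
      moreover have "(x(k := False))(k := True) = x" using True by (simp add: fun_upd_idem)
      ultimately show False using E(2) True by simp
    next
      case False
      then show False using E(1) edge[OF hx] by simp
    qed
  qed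
  then have "{p. p \<in> E \<longleftrightarrow> p \<in> U} = - E" by auto
  then show ?thesis using U(2) by simp
qed

lemma borel_equivalence_perfectly_many_classes:
  fixes E :: "('a::polish_space \<times> 'a) set"
  assumes equiv: "equiv UNIV E" and B: "B \<in> sets borel" and EB: "E \<inter> (B \<times> B) \<in> sets borel"
    and positive: "B \<notin> class_ideal E"
  shows "perfectly_many_classes E"
proof -
  have "B \<times> B - E \<inter> (B \<times> B) \<in> sets borel" using B EB by (intro sets.Diff borel_Times)
  moreover have "B \<times> B - E \<inter> (B \<times> B) = B \<times> B - E" by blast
  ultimately have "projection_of_closed (B \<times> B - E)"
    using borel_imp_projection_of_closed by metis
  then obtain F :: "(('a \<times> 'a) \<times> (nat \<Rightarrow> nat)) set" where F: "closed F" "B \<times> B - E = fst ` F"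
    unfolding projection_of_closed_def by blast
  have uncov: "\<Union>\<A> \<noteq> UNIV"
    if "countable \<A>" "\<And>A. A \<in> \<A> \<Longrightarrow> independent_set (fst ` F) A" for \<A>
    using class_ideal_independent_cover[OF that(1), of B E] that(2) positive F(2) by auto
  from continuous_homomorphism[OF F(1) uncov]
  obtain \<phi> :: "(nat \<Rightarrow> bool) \<Rightarrow> 'a" where \<phi>: "continuous_on UNIV \<phi>"
    and hom: "\<And>k x. hist x k = split_node k \<Longrightarrow> \<not> x k \<Longrightarrow> (\<phi> x, \<phi> (x(k := True))) \<in> fst ` F"
    by blast
  have edge: "(\<phi> x, \<phi> (x(k := True))) \<in> B \<times> B - E" if "hist x k = split_node k" "\<not> x k" for x k
    using hom[OF that] F(2) by simp
  \<comment> \<open>Level \<open>0\<close> splits at the empty list, so every sequence lies on an edge.\<close>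
  have "\<phi> x \<in> B" for x
  proof -
    have root: "hist y 0 = split_node 0" for y
      by (metis hist.simps(1) length_0_conv length_split_node)
    have "(\<phi> (x(0 := False)), \<phi> ((x(0 := False))(0 := True))) \<in> B \<times> B - E"
      by (rule edge[OF root]) simp
    then have "\<phi> (x(0 := c)) \<in> B" for c by (cases c) simp_all
    from this[of "x 0"] show ?thesis by simp
  qed
  define \<Phi> where "\<Phi> p = (\<phi> (fst p), \<phi> (snd p))" for p
  define E' where "E' = \<Phi> -` E"
  have "\<Phi> -` (E \<inter> (B \<times> B)) = E'" using \<open>\<And>x. \<phi> x \<in> B\<close> by (auto simp: \<Phi>_def E'_def)
  moreover have "continuous_on UNIV \<Phi>"
    unfolding \<Phi>_def
    by (intro continuous_on_Pair continuous_on_compose2[OF \<phi>] continuous_on_fst continuous_on_snd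
      continuous_on_id subset_UNIV)
  then have "\<Phi> \<in> borel_measurable borel" by (rule borel_measurable_continuous_onI)
  from measurable_sets[OF this EB] have "\<Phi> -` (E \<inter> (B \<times> B)) \<in> sets borel" by simp
  ultimately have "baire_property E'" using borel_imp_baire_property by metis
  moreover have "sym E'" "trans E'"
    using equiv unfolding equiv_def E'_def \<Phi>_def
    by (auto intro!: symI transI dest: symD transD)
  moreover have "(x, x(k := True)) \<notin> E'" if "hist x k = split_node k" "\<not> x k" for k x
    using edge[OF that] by (simp add: E'_def \<Phi>_def)
  ultimately have "comeager (- E')" by (rule equivalence_avoiding_edges_meager)
  then have "\<exists>\<psi> :: (nat \<Rightarrow> bool) \<Rightarrow> (nat \<Rightarrow> bool). continuous_on UNIV \<psi> \<and>
      (\<forall>x y. x \<noteq> y \<longrightarrow> (\<psi> x, \<psi> y) \<in> - E')"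
    by (rule comeager_square_contains_cantor_square)
  then obtain \<psi> :: "(nat \<Rightarrow> bool) \<Rightarrow> (nat \<Rightarrow> bool)" where \<psi>: "continuous_on UNIV \<psi>"
    "\<And>x y. x \<noteq> y \<Longrightarrow> (\<psi> x, \<psi> y) \<in> - E'"
    by blast
  define h where "h x = \<phi> (\<psi> x)" for x
  have inequivalent: "(h x, h y) \<notin> E" if "x \<noteq> y" for x y
    using \<psi>(2)[OF that] by (simp add: E'_def \<Phi>_def h_def)
  have "refl E" using equiv by (simp add: equiv_def)
  then have "inj h" using inequivalent by (metis injI reflD)
  moreover have "continuous_on UNIV h"
    unfolding h_def by (rule continuous_on_compose2[OF \<phi> \<psi>(1) subset_UNIV])
  ultimately have "perfect_set (range h)" by (intro perfect_set_range)
  moreover have "(a, b) \<notin> E" if "a \<in> range h" "b \<in> range h" "a \<noteq> b" for a b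
  proof -
    from that(1,2) obtain x y where "a = h x" "b = h y" by blast
    with that(3) inequivalent[of x y] show ?thesis by metis
  qed
  ultimately show ?thesis unfolding perfectly_many_classes_def by blast
qed

theorem proposition1p12:
  fixes E :: "('a::polish_space \<times> 'a) set"
  assumes "equiv UNIV E"
    and "analytic_set E"
    and "uncountable (UNIV // E)"
    and "\<not> perfectly_many_classes E"
  shows "\<forall>B. B \<in> sets borel \<and> B \<notin> class_ideal E \<longrightarrow> E \<inter> (B \<times> B) \<notin> sets borel"
  using borel_equivalence_perfectly_many_classes[OF assms(1)] assms(4) by blast

end
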